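(* Consider the linear model $\mathbf{y}=\mathbf{X}\beta^\star+\varepsilon$ with $\mathbf{y}\in\mathbb{R}^n$, $\mathbf{X}\in\mathbb{R}^{n\times p}$, where $\varepsilon=(\varepsilon_1,\ldots,\varepsilon_n)$ has i.i.d. sub-Gaussian$(\sigma)$ entries for some fixed constant $\sigma>0$, i.e. $E[\exp(t\varepsilon_i)]\le\exp(\sigma^2t^2/2)$ for all $t\in\mathbb{R}$. Let $\mathcal{A}=\{j:\beta^\star_j\neq0\}$, $s=|\mathcal{A}|$, let $\lambda>0$, let $P_\lambda$ be a folded concave penalty with constants $a_1,a_2,a$, let $a_0=\min\{1,a_2\}$, and suppose $\|\beta^\star_{\mathcal{A}}\|_{\min}>(a+1)\lambda$. Consider the folded concave penalized least squares problem $$\min_\beta\frac1{2n}\|\mathbf{y}-\mathbf{X}\beta\|_{\ell_2}^2+\sum_jP_\lambda(|\beta_j|).$$ Let $\delta_0=\Pr(\|\hat\beta^{\mathrm{initial}}-\beta^\star\|_{\max}>a_0\lambda)$. Then the LLA algorithm initialized by $\hat\beta^{\mathrm{initial}}$ converges to $\hat\beta^{\mathrm{oracle}}$ after two iterations with probability at least $1-\delta_0-\delta_1^{\mathrm{linear}}-\delta_2^{\mathrm{linear}}$, where $$\delta_1^{\mathrm{linear}}=2(p-s)\exp\left(-\frac{a_1^2n\lambda^2}{2M\sigma^2}\right),\qquad \delta_2^{\mathrm{linear}}=2s\exp\left(-\frac{n\lambda_{\min}}{2\sigma^2}\left(\|\beta^\star_{\mathcal{A}}\|_{\min}-a\lambda\right)^2\right),$$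 with $\lambda_{\min}=\lambda_{\min}\left(\frac1n\mathbf{X}_{\mathcal{A}}'\mathbf{X}_{\mathcal{A}}\right)$ and $M=\max_j\frac1n\|\mathbf{x}_{(j)}\|_{\ell_2}^2$, $\mathbf{x}_{(j)}=(x_{1j},\ldots,x_{nj})'$.
   Context: The design $\mathbf{X}$ is treated as fixed. $\mathbf{X}_{\mathcal{A}}$ is the submatrix of columns in $\mathcal{A}$; $\lambda_{\min}(\cdot)$ of a symmetric matrix is its smallest eigenvalue. $\|v\|_{\max}=\max_j|v_j|$, $\|v\|_{\min}=\min_j|v_j|$. Folded concave penalty: $P_\lambda(|t|)$, $t\in\mathbb{R}$, where, for fixed constants $a_1,a_2>0$ and $a>a_2$: (i) $P_\lambda(t)$ is increasing and concave on $[0,\infty)$ with $P_\lambda(0)=0$; (ii) $P_\lambda$ is differentiable on $(0,\infty)$ with $P'_\lambda(0):=P'_\lambda(0+)\ge a_1\lambda$; (iii) $P'_\lambda(t)\ge a_1\lambda$ for $t\in(0,a_2\lambda]$; (iv) $P'_\lambda(t)=0$ for $t\in[a\lambda,\infty)$. Oracle estimator: the minimizer of $\ell_n(\beta)=\frac1{2n}\|\mathbf{y}-\mathbf{X}\beta\|_{\ell_2}^2$ over $\{\beta:\beta_{\mathcal{A}^c}=0\}$, i.e. $\hat\beta^{\mathrm{oracle}}=(\hat\beta^{\mathrm{oracle}}_{\mathcal{A}},0)$ with $\hat\beta^{\mathrm{oracle}}_{\mathcal{A}}=(\mathbf{X}_{\mathcal{A}}'\mathbf{X}_{\mathcal{A}})^{-1}\mathbf{X}_{\mathcal{A}}'\mathbf{y}$;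 as a standing assumption it is unique (equivalently $\mathbf{X}_{\mathcal{A}}'\mathbf{X}_{\mathcal{A}}$ is invertible). LLA algorithm: set $\hat\beta^{(0)}=\hat\beta^{\mathrm{initial}}$ (any, possibly data-dependent, estimator); for $m=1,2,\ldots$ let $\hat\beta^{(m)}=\arg\min_\beta\ \ell_n(\beta)+\sum_jP'_\lambda(|\hat\beta^{(m-1)}_j|)\,|\beta_j|$. "Converges to $\hat\beta^{\mathrm{oracle}}$ after two iterations" means $\hat\beta^{(1)}=\hat\beta^{(2)}=\hat\beta^{\mathrm{oracle}}$. *)

theory Defs
  imports
    "HOL-Probability.Probability"
    "Jordan_Normal_Form.Spectral_Radius"
    "Jordan_Normal_Form.DL_Submatrix"
begin

(* Vectors and matrices are those of Jordan_Normal_Form, with 0-based indices. *)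
no_notation inner (infix "\<bullet>" 70)
no_notation Finite_Cartesian_Product.vec_nth (infixl "$" 90)
hide_const (open) Finite_Cartesian_Product.vec_nth Finite_Cartesian_Product.vec
  Finite_Cartesian_Product.mat

definition norm_max :: "real vec \<Rightarrow> real" where
  "norm_max v = Max ((\<lambda>j. \<bar>v $ j\<bar>) ` {..<dim_vec v})"

(* Meaningful only for a nonempty finite index set A. *)
definition norm_min_on :: "nat set \<Rightarrow> real vec \<Rightarrow> real" where
  "norm_min_on A v = Min ((\<lambda>j. \<bar>v $ j\<bar>) ` A)"

definition support :: "real vec \<Rightarrow> nat set" where
  "support v = {j. j < dim_vec v \<and> v $ j \<noteq> 0}"

definition lambda_min :: "real mat \<Rightarrow> real" where
  "lambda_min G = Min (Collect (eigenvalue G))"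

definition col_submatrix :: "real mat \<Rightarrow> nat set \<Rightarrow> real mat" where
  "col_submatrix X A = submatrix X UNIV A"

definition max_col_norm2 :: "real mat \<Rightarrow> real" where
  "max_col_norm2 X =
     Max ((\<lambda>j. (1 / real (dim_row X)) * (col X j \<bullet> col X j)) ` {..<dim_col X})"

definition ls_loss :: "real mat \<Rightarrow> real vec \<Rightarrow> real vec \<Rightarrow> real" where
  "ls_loss X y \<beta> =
     1 / (2 * real (dim_row X)) * ((y - X *\<^sub>v \<beta>) \<bullet> (y - X *\<^sub>v \<beta>))"

(* The value at 0 is the right limit P'(0+), not deriv P 0. *)
definition penalty_deriv :: "(real \<Rightarrow> real) \<Rightarrow> real \<Rightarrow> real" where
  "penalty_deriv P t = (if t = 0 then Lim (at_right 0) (deriv P) else deriv P t)"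

(* P is the single function P_lambda at the given value lam of lambda; only its values on
   [0, \<infinity>) matter. "Increasing" is non-strict, as the derivative vanishes
   on [a * lam, \<infinity>). P'(0+) is a finite real, since it serves as a weight
   in the LLA algorithm. *)
definition folded_concave_penalty ::
    "real \<Rightarrow> real \<Rightarrow> real \<Rightarrow> real \<Rightarrow> (real \<Rightarrow> real) \<Rightarrow> bool" where
  "folded_concave_penalty a1 a2 a lam P \<longleftrightarrow>
     0 < a1 \<and> 0 < a2 \<and> a2 < a \<and>
     mono_on {0..} P \<and> concave_on {0..} P \<and> P 0 = 0 \<and>
     (\<forall>t>0. P differentiable (at t)) \<and>
     (\<exists>d. (deriv P \<longlongrightarrow> d) (at_right 0)) \<and> penalty_deriv P 0 \<ge> a1 * lam \<and>
     (\<forall>t\<in>{0<..a2 * lam}. penalty_deriv P t \<ge> a1 * lam) \<and>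
     (\<forall>t\<in>{a * lam..}. penalty_deriv P t = 0)"

definition is_oracle_estimator :: "real mat \<Rightarrow> real vec \<Rightarrow> nat set \<Rightarrow> real vec \<Rightarrow> bool" where
  "is_oracle_estimator X y A =
     is_arg_min (ls_loss X y)
       (\<lambda>\<beta>. \<beta> \<in> carrier_vec (dim_col X) \<and> (\<forall>j<dim_col X. j \<notin> A \<longrightarrow> \<beta> $ j = 0))"

definition oracle_estimator :: "real mat \<Rightarrow> real vec \<Rightarrow> nat set \<Rightarrow> real vec" where
  "oracle_estimator X y A = (THE \<beta>. is_oracle_estimator X y A \<beta>)"

definition lla_objective ::
    "real mat \<Rightarrow> real vec \<Rightarrow> (real \<Rightarrow> real) \<Rightarrow> real vec \<Rightarrow> real vec \<Rightarrow> real" where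
  "lla_objective X y P \<beta>' \<beta> =
     ls_loss X y \<beta> + (\<Sum>j<dim_col X. penalty_deriv P \<bar>\<beta>' $ j\<bar> * \<bar>\<beta> $ j\<bar>)"

(* Minimizers of the weighted l1 problem need not be unique, so this is a relation: b is one
   possible run of the algorithm. *)
definition lla_run ::
    "real mat \<Rightarrow> real vec \<Rightarrow> (real \<Rightarrow> real) \<Rightarrow> real vec \<Rightarrow> (nat \<Rightarrow> real vec) \<Rightarrow> bool" where
  "lla_run X y P init b \<longleftrightarrow>
     b 0 = init \<and>
     (\<forall>m. is_arg_min (lla_objective X y P (b m)) (\<lambda>\<beta>. \<beta> \<in> carrier_vec (dim_col X)) (b (Suc m)))"

definition random_vector :: "'w measure \<Rightarrow> nat \<Rightarrow> ('w \<Rightarrow> real vec) \<Rightarrow> bool" where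
  "random_vector M p Z \<longleftrightarrow>
     (\<forall>\<omega>\<in>space M. Z \<omega> \<in> carrier_vec p) \<and>
     (\<forall>j<p. (\<lambda>\<omega>. Z \<omega> $ j) \<in> borel_measurable M)"

(* Integrability is explicit: the Bochner integral of a non-integrable function is 0. *)
definition sub_gaussian :: "'w measure \<Rightarrow> real \<Rightarrow> ('w \<Rightarrow> real) \<Rightarrow> bool" where
  "sub_gaussian M \<sigma> Z \<longleftrightarrow>
     (\<forall>t. integrable M (\<lambda>\<omega>. exp (t * Z \<omega>)) \<and>
          (\<integral>\<omega>. exp (t * Z \<omega>) \<partial>M) \<le> exp (\<sigma>\<^sup>2 * t\<^sup>2 / 2))"

definition iid :: "'w measure \<Rightarrow> (nat \<Rightarrow> 'w \<Rightarrow> real) \<Rightarrow> nat \<Rightarrow> bool" where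
  "iid M \<epsilon> n \<longleftrightarrow>
     prob_space.indep_vars M (\<lambda>_. borel) \<epsilon> {..<n} \<and>
     (\<forall>i<n. \<forall>j<n. distr M borel (\<epsilon> i) = distr M borel (\<epsilon> j))"

end

theory Submission
  imports Defs
begin

text \<open>
  If the weights of an LLA step vanish on \<open>A\<close> and are at least \<open>a1 * lam\<close> off \<open>A\<close>, and the gradient of
  the loss at the oracle is smaller than \<open>a1 * lam\<close> in the coordinates off \<open>A\<close>, then the oracle is the
  unique minimizer of that step. An initial estimator within \<open>a0 * lam\<close> of the truth produces such
  weights, and so does the oracle itself once its active coordinates exceed \<open>a * lam\<close>.

  It remains to control two events. The gradient off \<open>A\<close> and the estimation error of the oracle
  on \<open>A\<close> are linear forms \<open>r \<bullet> e\<close> in the noise. In the first case \<open>r\<close> is a column of \<open>X\<close> projected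
  away from the active columns, so its norm does not exceed that of the column; in the second,
  \<open>r \<bullet> r\<close> is a diagonal entry of the inverse Gram matrix, hence at most \<open>1 / (n * lambda_min)\<close> by the
  Rayleigh bound. The Chernoff bound for sub-Gaussian linear forms and a union bound conclude.
\<close>

section \<open>Smallest eigenvalue of a symmetric matrix\<close>

text \<open>For \<open>\<alpha> > 0\<close>, evaluate at the minimizer
  \<open>- \<beta> / \<alpha>\<close>. For \<open>\<alpha> = 0\<close> and
  \<open>\<beta> \<noteq> 0\<close>, the point \<open>- (\<gamma> + 1) / (2 * \<beta>)\<close> would
  give the value -1.\<close>

lemma nonneg_quadratic_discriminant:
  fixes \<alpha> \<beta> \<gamma> :: real
  assumes q: "\<And>t. 0 \<le> \<alpha> * t\<^sup>2 + 2 * \<beta> * t + \<gamma>" and \<alpha>: "0 \<le> \<alpha>"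
  shows "\<beta>\<^sup>2 \<le> \<alpha> * \<gamma>"
proof (cases "\<alpha> = 0")
  case True
  have "\<beta> = 0"
    using q[of "- (\<gamma> + 1) / (2 * \<beta>)"] True by (cases "\<beta> = 0") (auto simp: field_simps)
  then show ?thesis using True by simp
next
  case False
  then show ?thesis
    using q[of "- \<beta> / \<alpha>"] \<alpha> by (auto simp: field_simps power2_eq_square)
qed

lemma scalar_prod_self_nonneg: "0 \<le> v \<bullet> (v :: real vec)"
  by (auto simp: scalar_prod_def intro!: sum_nonneg)

lemma scalar_prod_self_eq_0_iff:
  fixes v :: "real vec"
  assumes "v \<in> carrier_vec n"
  shows "v \<bullet> v = 0 \<longleftrightarrow> v = 0\<^sub>v n"
  using assms
  by (auto simp: scalar_prod_def sum_nonneg_eq_0_iff intro!: eq_vecI)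

lemma square_component_le_scalar_prod:
  fixes v :: "real vec"
  assumes "v \<in> carrier_vec n" "i < n"
  shows "(v $ i)\<^sup>2 \<le> v \<bullet> v"
proof -
  have "v $ i * v $ i \<le> (\<Sum>k\<in>{0..<n}. v $ k * v $ k)"
    by (rule member_le_sum) (use assms in auto)
  then show ?thesis using assms by (simp add: scalar_prod_def power2_eq_square)
qed

text \<open>The form at \<open>t u + v\<close> is a quadratic polynomial in \<open>t\<close> that is
  never negative, so its discriminant is bounded.\<close>

lemma psd_Cauchy_Schwarz:
  fixes S :: "real mat"
  assumes S: "S \<in> carrier_mat n n" and sym: "S\<^sup>T = S"
    and psd: "\<And>v. v \<in> carrier_vec n \<Longrightarrow> 0 \<le> v \<bullet> (S *\<^sub>v v)"
    and u: "u \<in> carrier_vec n" and v: "v \<in> carrier_vec n"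
  shows "(u \<bullet> (S *\<^sub>v v))\<^sup>2 \<le> (u \<bullet> (S *\<^sub>v u)) * (v \<bullet> (S *\<^sub>v v))"
proof (rule nonneg_quadratic_discriminant)
  fix t :: real
  have Su: "S *\<^sub>v u \<in> carrier_vec n" and Sv: "S *\<^sub>v v \<in> carrier_vec n"
    using S u v by auto
  have vSu: "v \<bullet> (S *\<^sub>v u) = u \<bullet> (S *\<^sub>v v)"
    using transpose_vec_mult_scalar[OF S u v] sym comm_scalar_prod[OF u Sv]
      comm_scalar_prod[OF v Su] transpose_vec_mult_scalar[OF S v u] by simp
  have "0 \<le> (t \<cdot>\<^sub>v u + v) \<bullet> (S *\<^sub>v (t \<cdot>\<^sub>v u + v))"
    using u v by (intro psd) auto
  also have "S *\<^sub>v (t \<cdot>\<^sub>v u + v) = t \<cdot>\<^sub>v (S *\<^sub>v u) + S *\<^sub>v v"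
    using S u v by (simp add: mult_add_distrib_mat_vec[of _ n n] mult_mat_vec[of _ n n])
  also have "(t \<cdot>\<^sub>v u + v) \<bullet> (t \<cdot>\<^sub>v (S *\<^sub>v u) + S *\<^sub>v v) =
      (u \<bullet> (S *\<^sub>v u)) * t\<^sup>2 + 2 * (u \<bullet> (S *\<^sub>v v)) * t + v \<bullet> (S *\<^sub>v v)"
    using u v Su Sv vSu
    by (simp add: add_scalar_prod_distrib[of _ n] scalar_prod_add_distrib[of _ n]
        power2_eq_square algebra_simps)
  finally show "0 \<le> (u \<bullet> (S *\<^sub>v u)) * t\<^sup>2 + 2 * (u \<bullet> (S *\<^sub>v v)) * t + v \<bullet> (S *\<^sub>v v)" .
qed (use psd u in auto)

lemma quadratic_form_bounded:
  fixes S :: "real mat"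
  assumes S: "S \<in> carrier_mat n n"
  obtains K where "0 < K" "\<And>v. v \<in> carrier_vec n \<Longrightarrow> \<bar>v \<bullet> (S *\<^sub>v v)\<bar> \<le> K * (v \<bullet> v)"
proof
  \<comment> \<open>The sum of absolute entries suffices because each product
    \<open>v $ i * v $ j\<close> is at most \<open>v \<bullet> v\<close> in modulus. The extra 1
    keeps \<open>K\<close> positive for the zero matrix; a reciprocal of such a bound is taken
    later.\<close>
  define K where "K = (\<Sum>i<n. \<Sum>j<n. \<bar>S $$ (i, j)\<bar>) + 1"
  show "0 < K"
    unfolding K_def by (intro add_nonneg_pos sum_nonneg) auto
  fix v :: "real vec" assume v: "v \<in> carrier_vec n"
  have vv: "\<bar>v $ i * v $ j\<bar> \<le> v \<bullet> v" if "i < n" "j < n" for i j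
  proof -
    have "0 \<le> (\<bar>v $ i\<bar> - \<bar>v $ j\<bar>)\<^sup>2" by simp
    also have "\<dots> = (v $ i)\<^sup>2 + (v $ j)\<^sup>2 - 2 * \<bar>v $ i * v $ j\<bar>"
      by (simp add: power2_diff abs_mult)
    finally show ?thesis
      using square_component_le_scalar_prod[OF v that(1)]
        square_component_le_scalar_prod[OF v that(2)] by linarith
  qed
  have "v \<bullet> (S *\<^sub>v v) = (\<Sum>i<n. \<Sum>j<n. S $$ (i, j) * (v $ i * v $ j))"
    using S v by (auto simp: scalar_prod_def sum_distrib_left atLeast0LessThan intro!: sum.cong)
  also have "\<bar>\<dots>\<bar> \<le> (\<Sum>i<n. \<Sum>j<n. \<bar>S $$ (i, j)\<bar> * (v \<bullet> v))"
    by (intro order.trans[OF sum_abs] sum_mono) (auto simp: abs_mult[of "S $$ _"] intro!: mult_left_mono vv)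
  also have "\<dots> \<le> K * (v \<bullet> v)"
    using scalar_prod_self_nonneg[of v]
    by (simp add: K_def sum_distrib_right distrib_right)
  finally show "\<bar>v \<bullet> (S *\<^sub>v v)\<bar> \<le> K * (v \<bullet> v)" .
qed

lemma ex_inverse_mat:
  fixes S :: "'a :: field mat"
  assumes S: "S \<in> carrier_mat n n"
    and inj: "\<And>v. v \<in> carrier_vec n \<Longrightarrow> S *\<^sub>v v = 0\<^sub>v n \<Longrightarrow> v = 0\<^sub>v n"
  obtains T where "T \<in> carrier_mat n n" "S * T = 1\<^sub>m n"
proof -
  have "det S \<noteq> 0"
    using inj det_0_iff_vec_prod_zero_field[OF S] by blast
  from det_non_zero_imp_unit[OF S this, of "()"] that show thesis
    by (auto simp: Units_def ring_mat_def)
qed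

text \<open>The best constant \<open>\<mu>\<close> in \<open>\<mu> (v \<bullet> v) \<le> v \<bullet> S v\<close> is an eigenvalue:
  otherwise \<open>S - \<mu> I\<close> is positive semidefinite and invertible, so Cauchy-Schwarz
  for its quadratic form bounds that form below by a positive multiple of \<open>v \<bullet> v\<close>.\<close>
lemma symmetric_mat_Rayleigh_eigenvalue:
  fixes S :: "real mat"
  assumes S: "S \<in> carrier_mat n n" and sym: "S\<^sup>T = S" and n: "0 < n"
  obtains \<mu> where "eigenvalue S \<mu>"
    "\<And>v. v \<in> carrier_vec n \<Longrightarrow> \<mu> * (v \<bullet> v) \<le> v \<bullet> (S *\<^sub>v v)"
proof -
  define L where "L = {m. \<forall>v\<in>carrier_vec n. m * (v \<bullet> v) \<le> v \<bullet> (S *\<^sub>v v)}"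
  define \<mu> where "\<mu> = Sup L"
  obtain K where K: "\<And>v. v \<in> carrier_vec n \<Longrightarrow> \<bar>v \<bullet> (S *\<^sub>v v)\<bar> \<le> K * (v \<bullet> v)"
    using quadratic_form_bounded[OF S] by blast
  have "- K \<in> L"
    unfolding L_def using K by (force simp: abs_le_iff)
  then have ne: "L \<noteq> {}" by blast
  \<comment> \<open>Testing on the first unit vector bounds \<open>L\<close>; this is where
    \<open>0 < n\<close> enters.\<close>
  have bdd: "bdd_above L"
  proof (rule bdd_aboveI)
    fix m assume "m \<in> L"
    then have "m * (unit_vec n 0 \<bullet> unit_vec n 0) \<le> unit_vec n 0 \<bullet> (S *\<^sub>v unit_vec n 0)"
      by (auto simp: L_def)
    then show "m \<le> unit_vec n 0 \<bullet> (S *\<^sub>v unit_vec n 0)"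
      using n by simp
  qed
  \<comment> \<open>The supremum is attained: every member of \<open>L\<close> is at most the
    Rayleigh quotient of \<open>v\<close>, hence so is \<open>\<mu>\<close>.\<close>
  have \<mu>: "\<mu> * (v \<bullet> v) \<le> v \<bullet> (S *\<^sub>v v)" if v: "v \<in> carrier_vec n" for v
  proof (cases "v \<bullet> v = 0")
    case True
    then have "v = 0\<^sub>v n" using scalar_prod_self_eq_0_iff[OF v] by simp
    then show ?thesis using S by simp
  next
    case False
    then have pos: "0 < v \<bullet> v" using scalar_prod_self_nonneg[of v] by simp
    have "\<mu> \<le> (v \<bullet> (S *\<^sub>v v)) / (v \<bullet> v)"
      unfolding \<mu>_def
      by (intro cSup_least ne) (use v pos in \<open>auto simp: L_def field_simps\<close>)
    then show ?thesis using pos by (simp add: field_simps)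
  qed
  have "eigenvalue S \<mu>"
  proof (rule ccontr)
    assume not_ev: "\<not> eigenvalue S \<mu>"
    define B where "B = S - \<mu> \<cdot>\<^sub>m 1\<^sub>m n"
    have B: "B \<in> carrier_mat n n" using S by (simp add: B_def minus_carrier_mat)
    have Bv: "B *\<^sub>v v = S *\<^sub>v v - \<mu> \<cdot>\<^sub>v v" if "v \<in> carrier_vec n" for v
    proof -
      have "(\<mu> \<cdot>\<^sub>m 1\<^sub>m n) *\<^sub>v v = \<mu> \<cdot>\<^sub>v v"
        using that by (intro eq_vecI) (auto simp: scalar_prod_left_unit[of _ n])
      then show ?thesis
        using S that by (simp add: B_def minus_mult_distrib_mat_vec[of _ n n])
    qed
    have form: "v \<bullet> (B *\<^sub>v v) = v \<bullet> (S *\<^sub>v v) - \<mu> * (v \<bullet> v)" if "v \<in> carrier_vec n" for v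
      using S that by (simp add: Bv scalar_prod_minus_distrib[of _ n])
    have "B\<^sup>T = S\<^sup>T - \<mu> \<cdot>\<^sub>m 1\<^sub>m n"
      using S by (intro eq_matI) (auto simp: B_def)
    then have symB: "B\<^sup>T = B" by (simp add: sym B_def)
    have psd: "0 \<le> v \<bullet> (B *\<^sub>v v)" if "v \<in> carrier_vec n" for v
      using \<mu>[OF that] form[OF that] by simp
    have "v = 0\<^sub>v n" if v: "v \<in> carrier_vec n" and 0: "B *\<^sub>v v = 0\<^sub>v n" for v
    proof -
      have "S *\<^sub>v v = \<mu> \<cdot>\<^sub>v v"
      proof (intro eq_vecI)
        fix i assume i: "i < dim_vec (\<mu> \<cdot>\<^sub>v v)"
        with 0 v S show "(S *\<^sub>v v) $ i = (\<mu> \<cdot>\<^sub>v v) $ i"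
          using Bv[OF v] by (metis carrier_vecD dim_mult_mat_vec carrier_matD(1) index_minus_vec(1)
              index_smult_vec(2) index_zero_vec(1) right_minus_eq)
      qed (use S v in auto)
      with not_ev v S show ?thesis
        by (auto simp: eigenvalue_def eigenvector_def)
    qed
    then obtain T where T: "T \<in> carrier_mat n n" "B * T = 1\<^sub>m n"
      using ex_inverse_mat[OF B] by blast
    obtain k where k: "0 < k" "\<And>v. v \<in> carrier_vec n \<Longrightarrow> \<bar>v \<bullet> (T *\<^sub>v v)\<bar> \<le> k * (v \<bullet> v)"
      using quadratic_form_bounded[OF T(1)] by blast
    have "v \<bullet> v \<le> k * (v \<bullet> (B *\<^sub>v v))" if v: "v \<in> carrier_vec n" for v
    proof (cases "v \<bullet> v = 0")
      case True
      then show ?thesis using psd[OF v] k by simp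
    next
      case False
      then have pos: "0 < v \<bullet> v" using scalar_prod_self_nonneg[of v] by simp
      \<comment> \<open>Since \<open>B u = v\<close>, the mixed term in Cauchy-Schwarz is
        \<open>v \<bullet> v\<close>, and the form of \<open>B\<close> at \<open>u\<close> is the
        form of \<open>T\<close> at \<open>v\<close>, which is bounded by \<open>k\<close>.\<close>
      define u where "u = T *\<^sub>v v"
      have u: "u \<in> carrier_vec n" using T v by (simp add: u_def)
      have Bu: "B *\<^sub>v u = v"
        using B T v by (simp add: u_def assoc_mult_mat_vec[symmetric, of _ n n _ n])
      have "(v \<bullet> v)\<^sup>2 = (v \<bullet> (B *\<^sub>v u))\<^sup>2" by (simp add: Bu)
      also have "\<dots> \<le> (v \<bullet> (B *\<^sub>v v)) * (u \<bullet> (B *\<^sub>v u))"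
        by (rule psd_Cauchy_Schwarz[OF B symB psd v u])
      also have "u \<bullet> (B *\<^sub>v u) = v \<bullet> (T *\<^sub>v v)"
        using comm_scalar_prod[OF u v] unfolding Bu by (simp add: u_def)
      also have "(v \<bullet> (B *\<^sub>v v)) * (v \<bullet> (T *\<^sub>v v)) \<le> (v \<bullet> (B *\<^sub>v v)) * (k * (v \<bullet> v))"
        using k(2)[OF v] psd[OF v] by (intro mult_left_mono) auto
      finally show ?thesis using pos by (simp add: power2_eq_square mult_ac)
    qed
    \<comment> \<open>The form of \<open>S\<close> exceeds \<open>\<mu> (v \<bullet> v)\<close> by
      at least \<open>(v \<bullet> v) / k\<close>, so \<open>\<mu>\<close> was not the
      supremum.\<close>
    then have "\<mu> + 1 / k \<in> L"
      using k(1) by (auto simp: L_def form field_simps)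
    then have "\<mu> + 1 / k \<le> \<mu>"
      using cSup_upper bdd unfolding \<mu>_def by blast
    then show False using k(1) by simp
  qed
  with \<mu> that show thesis by blast
qed

text \<open>\<open>Min\<close> is meaningful only on a finite nonempty set: the spectrum is finite,
  and the Rayleigh eigenvalue shows that it is nonempty. As \<open>lambda_min S\<close> lies below
  that eigenvalue, it inherits the Rayleigh bound.\<close>

lemma eigenvalue_lambda_min:
  assumes S: "S \<in> carrier_mat n n" and "S\<^sup>T = S" and "0 < n"
  shows "eigenvalue S (lambda_min S)"
    and "v \<in> carrier_vec n \<Longrightarrow> lambda_min S * (v \<bullet> v) \<le> v \<bullet> (S *\<^sub>v v)"
proof -
  obtain \<mu> where \<mu>: "eigenvalue S \<mu>"
    "\<And>v. v \<in> carrier_vec n \<Longrightarrow> \<mu> * (v \<bullet> v) \<le> v \<bullet> (S *\<^sub>v v)"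
    using symmetric_mat_Rayleigh_eigenvalue[OF assms] by blast
  have fin: "finite (Collect (eigenvalue S))"
    using card_finite_spectrum(1)[OF S] by (simp add: spectrum_def)
  then show "eigenvalue S (lambda_min S)"
    using \<mu>(1) Min_in[of "Collect (eigenvalue S)"] by (auto simp: lambda_min_def)
  have "lambda_min S \<le> \<mu>"
    using fin \<mu>(1) by (simp add: lambda_min_def)
  then show "v \<in> carrier_vec n \<Longrightarrow> lambda_min S * (v \<bullet> v) \<le> v \<bullet> (S *\<^sub>v v)"
    using \<mu>(2)[of v] mult_right_mono[OF _ scalar_prod_self_nonneg, of "lambda_min S" \<mu> v] by linarith
qed

section \<open>Sub-Gaussian linear forms\<close>

text \<open>By independence the moment generating function of the sum is a product, and the
  exponents \<open>\<sigma>^2 (t c_i)^2 / 2\<close> add up.\<close>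

lemma (in prob_space) sub_gaussian_linear_combination:
  assumes indep: "indep_vars (\<lambda>_. borel) \<epsilon> I" and fin: "finite I"
    and sg: "\<And>i. i \<in> I \<Longrightarrow> sub_gaussian M \<sigma> (\<epsilon> i)"
  shows "sub_gaussian M (\<sigma> * sqrt (\<Sum>i\<in>I. (c i)\<^sup>2)) (\<lambda>\<omega>. \<Sum>i\<in>I. c i * \<epsilon> i \<omega>)"
  unfolding sub_gaussian_def
proof (intro allI conjI)
  fix t :: real
  let ?E = "\<lambda>i \<omega>. exp (t * c i * \<epsilon> i \<omega>)"
  have eq: "(\<lambda>\<omega>. exp (t * (\<Sum>i\<in>I. c i * \<epsilon> i \<omega>))) = (\<lambda>\<omega>. \<Prod>i\<in>I. ?E i \<omega>)"
    using fin by (auto simp: sum_distrib_left exp_sum mult.assoc)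
  have ind: "indep_vars (\<lambda>_. borel) ?E I"
    using indep by (rule indep_vars_compose2) auto
  have int: "integrable M (?E i)" and le: "expectation (?E i) \<le> exp (\<sigma>\<^sup>2 * (t * c i)\<^sup>2 / 2)"
    if "i \<in> I" for i
    using sg[OF that] by (auto simp: sub_gaussian_def)
  show "integrable M (\<lambda>\<omega>. exp (t * (\<Sum>i\<in>I. c i * \<epsilon> i \<omega>)))"
    unfolding eq by (rule indep_vars_integrable[OF fin ind int])
  have "expectation (\<lambda>\<omega>. \<Prod>i\<in>I. ?E i \<omega>) = (\<Prod>i\<in>I. expectation (?E i))"
    by (rule indep_vars_lebesgue_integral[OF fin ind int])
  also have "\<dots> \<le> (\<Prod>i\<in>I. exp (\<sigma>\<^sup>2 * (t * c i)\<^sup>2 / 2))"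
    by (intro prod_mono conjI le integral_nonneg_AE) auto
  also have "\<dots> = exp ((\<sigma> * sqrt (\<Sum>i\<in>I. (c i)\<^sup>2))\<^sup>2 * t\<^sup>2 / 2)"
    using fin
    by (simp add: exp_sum[symmetric] power_mult_distrib sum_nonneg sum_distrib_left
        sum_divide_distrib mult_ac)
  finally show "expectation (\<lambda>\<omega>. exp (t * (\<Sum>i\<in>I. c i * \<epsilon> i \<omega>)))
      \<le> exp ((\<sigma> * sqrt (\<Sum>i\<in>I. (c i)\<^sup>2))\<^sup>2 * t\<^sup>2 / 2)"
    unfolding eq .
qed

text \<open>The Chernoff bound is applied to both signs of \<open>Z\<close>. A positive upper bound
  \<open>V\<close> replaces the exact proxy, so only an estimate of the norm of a linear form is
  needed and degenerate forms are covered.\<close>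

lemma (in prob_space) sub_gaussian_tail:
  assumes sg: "sub_gaussian M \<tau> Z" and [measurable]: "Z \<in> borel_measurable M"
    and V: "\<tau>\<^sup>2 \<le> V" "0 < V" and x: "0 \<le> x"
  shows "prob {\<omega>\<in>space M. x \<le> \<bar>Z \<omega>\<bar>} \<le> 2 * exp (- (x\<^sup>2 / (2 * V)))"
proof (cases "x = 0")
  case True
  then show ?thesis by (simp add: order.trans[OF prob_le_1])
next
  case False
  \<comment> \<open>This \<open>t\<close> minimizes the exponent
    \<open>- t * x + V * t^2 / 2\<close>. It is positive, as Chernoff requires, only for
    \<open>x > 0\<close>; at \<open>x = 0\<close> the claimed bound is 2.\<close>
  define t where "t = x / V"
  have t: "0 < t" using x V False by (simp add: t_def)
  have bound: "prob {\<omega>\<in>space M. x \<le> u * Z \<omega>} \<le> exp (- (x\<^sup>2 / (2 * V)))" if u: "u\<^sup>2 = 1" for u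
  proof -
    have int: "integrable M (\<lambda>\<omega>. exp (t * (u * Z \<omega>)))"
      and le: "expectation (\<lambda>\<omega>. exp (t * (u * Z \<omega>))) \<le> exp (\<tau>\<^sup>2 * t\<^sup>2 / 2)"
      using sg[unfolded sub_gaussian_def, rule_format, of "t * u"] u
      by (simp_all add: mult.assoc power_mult_distrib)
    have sint: "set_integrable M (space M) (\<lambda>\<omega>. exp (t * (u * Z \<omega>)))"
      using int by (subst set_integrable_def) (simp cong: Bochner_Integration.integrable_cong)
    have "prob {\<omega>\<in>space M. x \<le> u * Z \<omega>} \<le>
        exp (- t * x) * (LINT \<omega>:space M|M. exp (t * (u * Z \<omega>)))"
      by (rule Chernoff_ineq_ge[OF t sint]) simp
    also have "(LINT \<omega>:space M|M. exp (t * (u * Z \<omega>))) = expectation (\<lambda>\<omega>. exp (t * (u * Z \<omega>)))"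
      by (rule set_integral_space[OF int])
    also have "exp (- t * x) * \<dots> \<le> exp (- t * x) * exp (V * t\<^sup>2 / 2)"
      using V(1) by (intro mult_left_mono order.trans[OF le]) (auto simp: mult_right_mono)
    also have "\<dots> = exp (- (x\<^sup>2 / (2 * V)))"
      using V(2) by (simp add: exp_add[symmetric] t_def power2_eq_square field_simps)
    finally show ?thesis .
  qed
  have "prob {\<omega>\<in>space M. x \<le> \<bar>Z \<omega>\<bar>} \<le>
      prob ({\<omega>\<in>space M. x \<le> 1 * Z \<omega>} \<union> {\<omega>\<in>space M. x \<le> (-1) * Z \<omega>})"
    by (intro finite_measure_mono) auto
  also have "\<dots> \<le> prob {\<omega>\<in>space M. x \<le> 1 * Z \<omega>} + prob {\<omega>\<in>space M. x \<le> (-1) * Z \<omega>}"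
    by (rule measure_Un_le) auto
  also have "\<dots> \<le> 2 * exp (- (x\<^sup>2 / (2 * V)))"
    using bound[of 1] bound[of "-1"] by simp
  finally show ?thesis .
qed

section \<open>Least squares on a fixed support\<close>

text \<open>\<open>submatrix\<close> numbers the selected columns by \<open>pick A\<close>; this
  bijection translates between that numbering and the original indices.\<close>

lemma bij_betw_pick:
  assumes "finite A"
  shows "bij_betw (pick A) {..<card A} A"
proof -
  have inj: "inj_on (pick A) {..<card A}"
    by (rule linorder_inj_onI') (metis lessThan_iff nat_neq_iff pick_mono_le)
  have "pick A ` {..<card A} \<subseteq> A"
    using pick_in_set_le by blast
  then have "pick A ` {..<card A} = A"
    by (intro card_subset_eq assms) (simp_all add: card_image inj)
  then show ?thesis using inj by (simp add: bij_betw_def)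
qed

locale sparse_design =
  fixes X :: "real mat" and n p :: nat and A :: "nat set"
  assumes X: "X \<in> carrier_mat n p" and n: "0 < n" and A: "A \<subseteq> {..<p}"
begin

text \<open>The feasible set of the oracle problem, kept as a subspace of the full space so that
  oracle and LLA iterates can be compared directly.\<close>

definition supported :: "real vec \<Rightarrow> bool" where
  "supported \<beta> \<longleftrightarrow> \<beta> \<in> carrier_vec p \<and> (\<forall>j<p. j \<notin> A \<longrightarrow> \<beta> $ j = 0)"

definition XA :: "real mat" where "XA = col_submatrix X A"

definition Gram :: "real mat" where "Gram = XA\<^sup>T * XA"

lemma finite_A: "finite A" using A finite_subset by blast

lemma dim_X[simp]: "dim_row X = n" "dim_col X = p"
  using X by auto

lemma mult_X_carrier[simp]: "X *\<^sub>v u \<in> carrier_vec n"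
  by (simp add: carrier_vecI)

lemma col_X_carrier[simp]: "col X j \<in> carrier_vec n"
  by (simp add: carrier_vecI)

lemma XA: "XA \<in> carrier_mat n (card A)"
proof -
  have "{j. j < p \<and> j \<in> A} = A" using A by auto
  then show ?thesis by (intro carrier_matI) (simp_all add: XA_def col_submatrix_def dim_submatrix)
qed

lemma dim_XA[simp]: "dim_row XA = n" "dim_col XA = card A"
  using XA by auto

lemma mult_XA_carrier[simp]: "XA *\<^sub>v u \<in> carrier_vec n"
  by (simp add: carrier_vecI)

lemma active_index:
  assumes "j \<in> A"
  obtains i where "i < card A" "j = pick A i"
  using bij_betw_imp_surj_on[OF bij_betw_pick[OF finite_A]] assms by (metis imageE lessThan_iff)

lemma pick_lt: "i < card A \<Longrightarrow> pick A i < p"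
  using pick_in_set_le A by blast

lemma col_XA:
  assumes i: "i < card A"
  shows "col XA i = col X (pick A i)"
proof (rule eq_vecI)
  fix k assume "k < dim_vec (col X (pick A i))"
  then have k: "k < n" using X by simp
  have "{j. j < p \<and> j \<in> A} = A" using A by auto
  then show "col XA i $ k = col X (pick A i) $ k"
    using k i pick_lt[OF i]
    by (simp add: col_def) (simp add: XA_def col_submatrix_def submatrix_index pick_UNIV)
qed simp

lemma supported_mult:
  assumes "supported \<beta>"
  shows "X *\<^sub>v \<beta> = XA *\<^sub>v vec (card A) (\<lambda>i. \<beta> $ pick A i)"
proof (rule eq_vecI)
  have \<beta>: "\<beta> \<in> carrier_vec p" "\<And>j. j < p \<Longrightarrow> j \<notin> A \<Longrightarrow> \<beta> $ j = 0"
    using assms by (auto simp: supported_def)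
  fix k assume "k < dim_vec (XA *\<^sub>v vec (card A) (\<lambda>i. \<beta> $ pick A i))"
  then have k: "k < n" by simp
  have entry: "X $$ (k, pick A i) = XA $$ (k, i)" if "i < card A" for i
    using arg_cong[OF col_XA[OF that], of "\<lambda>v. v $ k"] that k pick_lt[OF that] by simp
  have "(X *\<^sub>v \<beta>) $ k = (\<Sum>j<p. X $$ (k, j) * \<beta> $ j)"
    using k \<beta> by (simp add: scalar_prod_def atLeast0LessThan)
  also have "\<dots> = (\<Sum>j\<in>A. X $$ (k, j) * \<beta> $ j)"
    using A \<beta> by (intro sum.mono_neutral_right) auto
  also have "\<dots> = (\<Sum>i<card A. X $$ (k, pick A i) * \<beta> $ pick A i)"
    by (rule sum.reindex_bij_betw[symmetric, OF bij_betw_pick[OF finite_A]])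
  also have "\<dots> = (XA *\<^sub>v vec (card A) (\<lambda>i. \<beta> $ pick A i)) $ k"
    using k by (simp add: scalar_prod_def atLeast0LessThan entry)
  finally show "(X *\<^sub>v \<beta>) $ k = \<dots>" .
qed simp

lemma supported_extend:
  assumes v: "v \<in> carrier_vec (card A)"
  obtains \<beta> where "supported \<beta>" "vec (card A) (\<lambda>i. \<beta> $ pick A i) = v"
    "X *\<^sub>v \<beta> = XA *\<^sub>v v"
proof -
  define \<beta> where
    "\<beta> = vec p (\<lambda>j. if j \<in> A then v $ inv_into {..<card A} (pick A) j else 0)"
  have s: "supported \<beta>" by (simp add: supported_def \<beta>_def)
  have "vec (card A) (\<lambda>i. \<beta> $ pick A i) = v"
  proof (rule eq_vecI)
    fix i assume "i < dim_vec v"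
    then have i: "i < card A" using v by simp
    have "inv_into {..<card A} (pick A) (pick A i) = i"
      using bij_betw_inv_into_left[OF bij_betw_pick[OF finite_A]] i by simp
    then show "vec (card A) (\<lambda>i. \<beta> $ pick A i) $ i = v $ i"
      using i pick_lt[OF i] pick_in_set_le[OF i] by (simp add: \<beta>_def)
  qed (use v in simp)
  with s supported_mult[OF s] that show thesis by metis
qed

lemma scalar_prod_mult_cols:
  assumes u: "u \<in> carrier_vec p" and q: "q \<in> carrier_vec n"
  shows "(X *\<^sub>v u) \<bullet> q = (\<Sum>j<p. u $ j * (col X j \<bullet> q))"
proof -
  have "(X *\<^sub>v u) \<bullet> q = q \<bullet> (X *\<^sub>v u)"
    using u q by (intro comm_scalar_prod[of _ n]) auto
  also have "\<dots> = (X\<^sup>T *\<^sub>v q) \<bullet> u"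
    by (rule transpose_vec_mult_scalar[OF X u q, symmetric])
  also have "\<dots> = (\<Sum>j<p. u $ j * (col X j \<bullet> q))"
    using u by (simp add: scalar_prod_def[of "_ *\<^sub>v _"] atLeast0LessThan mult.commute)
  finally show ?thesis .
qed

text \<open>Since \<open>u\<close> vanishes off \<open>A\<close>, \<open>X u\<close> is a
  combination of active columns only.\<close>

lemma supported_orthogonal:
  assumes u: "supported u" and q: "q \<in> carrier_vec n"
    and orth: "\<And>j. j \<in> A \<Longrightarrow> col X j \<bullet> q = 0"
  shows "(X *\<^sub>v u) \<bullet> q = 0"
  using u scalar_prod_mult_cols[OF _ q, of u] orth
  by (force simp: supported_def intro!: sum.neutral)

text \<open>The exact second-order expansion of the loss. It serves the normal equations, the
  uniqueness argument and the analysis of an LLA step.\<close>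

lemma ls_loss_add:
  assumes y: "y \<in> carrier_vec n" and \<beta>: "\<beta> \<in> carrier_vec p" and d: "d \<in> carrier_vec p"
  shows "ls_loss X y (\<beta> + d) = ls_loss X y \<beta> - 1 / real n * ((X *\<^sub>v d) \<bullet> (y - X *\<^sub>v \<beta>))
    + 1 / (2 * real n) * ((X *\<^sub>v d) \<bullet> (X *\<^sub>v d))"
proof -
  define r where "r = y - X *\<^sub>v \<beta>"
  define e where "e = X *\<^sub>v d"
  have r: "r \<in> carrier_vec n" and e: "e \<in> carrier_vec n"
    using X y \<beta> d by (auto simp: r_def e_def)
  have "y - X *\<^sub>v (\<beta> + d) = r - e"
    using y \<beta> d X unfolding r_def e_def mult_add_distrib_mat_vec[OF X \<beta> d]
    by (intro eq_vecI) auto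
  moreover have "(r - e) \<bullet> (r - e) = r \<bullet> r - 2 * (e \<bullet> r) + e \<bullet> e"
    using r e comm_scalar_prod[OF r e]
    by (simp add: minus_scalar_prod_distrib[of _ n] scalar_prod_minus_distrib[of _ n])
  ultimately show ?thesis
    using X n unfolding ls_loss_def r_def[symmetric] e_def[symmetric]
    by (simp add: field_simps)
qed

lemma is_oracle_estimator_iff:
  "is_oracle_estimator X y A \<beta> \<longleftrightarrow>
    supported \<beta> \<and> (\<forall>\<gamma>. supported \<gamma> \<longrightarrow> ls_loss X y \<beta> \<le> ls_loss X y \<gamma>)"
  using X by (auto simp: is_oracle_estimator_def is_arg_min_linorder supported_def)

lemma supported_add: "supported \<beta> \<Longrightarrow> supported \<gamma> \<Longrightarrow> supported (\<beta> + \<gamma>)"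
  by (auto simp: supported_def)

text \<open>Moving the oracle by \<open>t\<close> along an active coordinate changes the loss by a
  quadratic in \<open>t\<close> without constant term. It is never negative, so the discriminant
  bound forces the linear coefficient to vanish.\<close>

lemma oracle_normal_equations:
  assumes y: "y \<in> carrier_vec n" and or: "is_oracle_estimator X y A \<beta>" and j: "j \<in> A"
  shows "col X j \<bullet> (y - X *\<^sub>v \<beta>) = 0"
proof -
  define g where "g = col X j \<bullet> (y - X *\<^sub>v \<beta>)"
  have jp: "j < p" using j A by auto
  have \<beta>: "supported \<beta>" "\<beta> \<in> carrier_vec p" using or by (auto simp: is_oracle_estimator_iff supported_def)
  have c: "col X j \<in> carrier_vec n" and r: "y - X *\<^sub>v \<beta> \<in> carrier_vec n" using X y \<beta> jp by auto
  have "0 \<le> (col X j \<bullet> col X j) * t\<^sup>2 + 2 * (- g) * t + 0" for t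
  proof -
    define d where "d = t \<cdot>\<^sub>v unit_vec p j"
    have d: "supported d" "d \<in> carrier_vec p" using j jp by (auto simp: d_def supported_def)
    have "X *\<^sub>v d = t \<cdot>\<^sub>v col X j"
      using jp by (intro eq_vecI) (auto simp: d_def scalar_prod_right_unit[of _ p])
    then have "ls_loss X y (\<beta> + d) - ls_loss X y \<beta> =
        1 / (2 * real n) * ((col X j \<bullet> col X j) * t\<^sup>2 + 2 * (- g) * t + 0)"
      using c r n unfolding ls_loss_add[OF y \<beta>(2) d(2)]
      by (simp add: smult_scalar_prod_distrib[of _ n] scalar_prod_smult_distrib[of _ n]
          g_def[symmetric] power2_eq_square diff_divide_distrib mult_ac)
    moreover have "0 \<le> ls_loss X y (\<beta> + d) - ls_loss X y \<beta>"
      using or supported_add[OF \<beta>(1) d(1)] by (simp add: is_oracle_estimator_iff)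
    ultimately show ?thesis
      using n by (simp add: zero_le_mult_iff zero_le_divide_iff)
  qed
  from nonneg_quadratic_discriminant[OF this] show ?thesis
    using scalar_prod_self_nonneg by (simp add: g_def)
qed

text \<open>Adding a supported kernel vector to the oracle leaves the loss unchanged and so gives
  another oracle. Uniqueness for one response thus yields linear independence of the active columns,
  a property of the design alone.\<close>

lemma unique_oracle_injective:
  assumes y: "y \<in> carrier_vec n" and un: "\<exists>!\<beta>. is_oracle_estimator X y A \<beta>"
    and d: "supported d" and 0: "X *\<^sub>v d = 0\<^sub>v n"
  shows "d = 0\<^sub>v p"
proof -
  obtain \<beta> where \<beta>: "is_oracle_estimator X y A \<beta>" using un by blast
  have \<beta>': "\<beta> \<in> carrier_vec p" and d': "d \<in> carrier_vec p"
    using \<beta> d by (auto simp: is_oracle_estimator_iff supported_def)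
  have "y - X *\<^sub>v \<beta> \<in> carrier_vec n" using y X \<beta>' by auto
  then have "ls_loss X y (\<beta> + d) = ls_loss X y \<beta>"
    unfolding ls_loss_add[OF y \<beta>' d'] 0 by simp
  then have "is_oracle_estimator X y A (\<beta> + d)"
    using \<beta> d by (simp add: is_oracle_estimator_iff supported_add)
  then have eq: "\<beta> + d = \<beta>" using \<beta> un by blast
  show ?thesis
  proof (rule eq_vecI)
    fix i assume "i < dim_vec (0\<^sub>v p)"
    then show "d $ i = 0\<^sub>v p $ i"
      using arg_cong[OF eq, of "\<lambda>v. v $ i"] \<beta>' d' by simp
  qed (use d' in simp)
qed


end

section \<open>Gram matrix, projections and LLA steps for linearly independent active
  columns\<close>

locale identifiable_design = sparse_design +
  assumes injective: "\<And>d. supported d \<Longrightarrow> X *\<^sub>v d = 0\<^sub>v n \<Longrightarrow> d = 0\<^sub>v p"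
begin

lemma Gram: "Gram \<in> carrier_mat (card A) (card A)" "Gram\<^sup>T = Gram"
  using XA by (auto simp: Gram_def transpose_mult[of _ _ n])

lemma Gram_mult:
  assumes v: "v \<in> carrier_vec (card A)"
  shows "Gram *\<^sub>v v = XA\<^sup>T *\<^sub>v (XA *\<^sub>v v)"
  unfolding Gram_def using XA v by (intro assoc_mult_mat_vec[of _ _ n _ "card A"]) auto

lemma Gram_form:
  assumes v: "v \<in> carrier_vec (card A)"
  shows "v \<bullet> (Gram *\<^sub>v v) = (XA *\<^sub>v v) \<bullet> (XA *\<^sub>v v)"
proof -
  have "v \<bullet> (XA\<^sup>T *\<^sub>v (XA *\<^sub>v v)) = (XA\<^sup>T *\<^sub>v (XA *\<^sub>v v)) \<bullet> v"
    using XA v by (intro comm_scalar_prod[of _ "card A"]) auto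
  then show ?thesis
    by (simp add: Gram_mult[OF v] transpose_vec_mult_scalar[OF XA v])
qed

lemma XA_injective:
  assumes v: "v \<in> carrier_vec (card A)" and 0: "XA *\<^sub>v v = 0\<^sub>v n"
  shows "v = 0\<^sub>v (card A)"
proof -
  obtain \<beta> where \<beta>: "supported \<beta>" "vec (card A) (\<lambda>i. \<beta> $ pick A i) = v" "X *\<^sub>v \<beta> = XA *\<^sub>v v"
    using supported_extend[OF v] by blast
  then have "\<beta> = 0\<^sub>v p" using injective 0 by simp
  then show ?thesis
    unfolding \<beta>(2)[symmetric] by (intro eq_vecI) (auto simp: pick_lt)
qed

text \<open>The Gram form at \<open>v\<close> is the squared norm of \<open>XA v\<close>, so the
  kernel of \<open>Gram\<close> is that of \<open>XA\<close>, which is trivial.\<close>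

lemma Gram_solvable:
  assumes c: "c \<in> carrier_vec (card A)"
  obtains v where "v \<in> carrier_vec (card A)" "Gram *\<^sub>v v = c"
proof -
  have "v = 0\<^sub>v (card A)" if v: "v \<in> carrier_vec (card A)" "Gram *\<^sub>v v = 0\<^sub>v (card A)" for v
    using Gram_form[OF v(1)] that scalar_prod_self_eq_0_iff[of "XA *\<^sub>v v" n]
    by (intro XA_injective) auto
  from ex_inverse_mat[OF Gram(1) this] obtain T where
    T: "T \<in> carrier_mat (card A) (card A)" "Gram * T = 1\<^sub>m (card A)" by blast
  show thesis
  proof (rule that)
    show "T *\<^sub>v c \<in> carrier_vec (card A)" using T c by auto
    show "Gram *\<^sub>v (T *\<^sub>v c) = c"
      using assoc_mult_mat_vec[OF Gram(1) T(1) c] T(2) c by simp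
  qed
qed

text \<open>Here \<open>X w\<close> is the orthogonal projection of \<open>q\<close> onto the span
  of the active columns.\<close>

lemma normal_equations_solvable:
  assumes q: "q \<in> carrier_vec n"
  obtains w where "supported w" "\<And>j. j \<in> A \<Longrightarrow> col X j \<bullet> (q - X *\<^sub>v w) = 0"
proof -
  have "XA\<^sup>T *\<^sub>v q \<in> carrier_vec (card A)" using XA q by auto
  then obtain v where v: "v \<in> carrier_vec (card A)" "Gram *\<^sub>v v = XA\<^sup>T *\<^sub>v q"
    using Gram_solvable by blast
  obtain w where w: "supported w" "X *\<^sub>v w = XA *\<^sub>v v"
    using supported_extend[OF v(1)] by blast
  have "col X j \<bullet> (q - X *\<^sub>v w) = 0" if jA: "j \<in> A" for j
  proof -
    obtain i where i: "i < card A" "j = pick A i"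
      using active_index[OF jA] by blast
    have "col XA i \<bullet> (XA *\<^sub>v v) = col XA i \<bullet> q"
      using arg_cong[OF v(2)[unfolded Gram_mult[OF v(1)]], of "\<lambda>u. u $ i"] i(1) by simp
    then show ?thesis
      using i q by (simp add: col_XA w(2) scalar_prod_minus_distrib[of _ n])
  qed
  with w(1) that show thesis by blast
qed

text \<open>The witness \<open>r\<close> is the component of column \<open>j\<close> orthogonal to the active columns.\<close>
lemma inactive_residual:
  assumes j: "j < p"
  obtains r where "r \<in> carrier_vec n" "r \<bullet> r \<le> col X j \<bullet> col X j"
    "\<And>\<beta>s e \<beta>. supported \<beta>s \<Longrightarrow> e \<in> carrier_vec n \<Longrightarrow>
      is_oracle_estimator X (X *\<^sub>v \<beta>s + e) A \<beta> \<Longrightarrow>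
      col X j \<bullet> (X *\<^sub>v \<beta>s + e - X *\<^sub>v \<beta>) = r \<bullet> e"
proof -
  let ?x = "col X j"
  obtain w where w: "supported w" "\<And>j'. j' \<in> A \<Longrightarrow> col X j' \<bullet> (?x - X *\<^sub>v w) = 0"
    using normal_equations_solvable[of ?x] by auto
  define r where "r = ?x - X *\<^sub>v w"
  have r: "r \<in> carrier_vec n" by (simp add: r_def)
  have orth: "(X *\<^sub>v u) \<bullet> r = 0" if "supported u" for u
    by (rule supported_orthogonal[OF that r]) (use w(2) in \<open>simp add: r_def\<close>)
  have x: "?x = X *\<^sub>v w + r"
    by (rule eq_vecI) (auto simp: r_def)
  have "?x \<bullet> ?x = (X *\<^sub>v w) \<bullet> (X *\<^sub>v w) + r \<bullet> r"
    using r orth[OF w(1)] comm_scalar_prod[OF r, of "X *\<^sub>v w"] unfolding x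
    by (simp add: add_scalar_prod_distrib[of _ n] scalar_prod_add_distrib[of _ n])
  then have le: "r \<bullet> r \<le> ?x \<bullet> ?x"
    using scalar_prod_self_nonneg[of "X *\<^sub>v w"] by simp
  \<comment> \<open>The vector \<open>r\<close> is fixed before truth, noise and oracle are chosen,
    so one deterministic \<open>r\<close> serves all outcomes.\<close>
  have "?x \<bullet> (X *\<^sub>v \<beta>s + e - X *\<^sub>v \<beta>) = r \<bullet> e"
    if \<beta>s: "supported \<beta>s" and e: "e \<in> carrier_vec n"
      and or: "is_oracle_estimator X (X *\<^sub>v \<beta>s + e) A \<beta>" for \<beta>s e \<beta>
  proof -
    have \<beta>: "supported \<beta>" using or by (simp add: is_oracle_estimator_iff)
    define f where "f = X *\<^sub>v \<beta>s + e - X *\<^sub>v \<beta>"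
    have f: "f \<in> carrier_vec n" using e by (simp add: f_def)
    have y: "X *\<^sub>v \<beta>s + e \<in> carrier_vec n" using e by simp
    \<comment> \<open>The oracle residual \<open>f\<close> is orthogonal to the active span, so only
      \<open>r\<close> contributes; \<open>r\<close> in turn annihilates both fitted parts of
      \<open>f\<close> and leaves the noise.\<close>
    have "?x \<bullet> f = (X *\<^sub>v w) \<bullet> f + r \<bullet> f"
      unfolding x using r f by (simp add: add_scalar_prod_distrib[of _ n])
    also have "(X *\<^sub>v w) \<bullet> f = 0"
      unfolding f_def
      by (rule supported_orthogonal[OF w(1)])
        (use e oracle_normal_equations[OF y or] in auto)
    also have "r \<bullet> f = r \<bullet> (X *\<^sub>v \<beta>s) + r \<bullet> e - r \<bullet> (X *\<^sub>v \<beta>)"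
      unfolding f_def using r e
      by (simp add: scalar_prod_add_distrib[of _ n] scalar_prod_minus_distrib[of _ n])
    also have "\<dots> = r \<bullet> e"
      using orth[OF \<beta>s] orth[OF \<beta>] comm_scalar_prod[OF r, of "X *\<^sub>v \<beta>s"]
        comm_scalar_prod[OF r, of "X *\<^sub>v \<beta>"] by simp
    finally show ?thesis by (simp add: f_def)
  qed
  with r le that show thesis by blast
qed

text \<open>The second claim is the Rayleigh bound rescaled by \<open>n\<close>. For positivity, the
  form at an eigenvector is both \<open>l (v \<bullet> v)\<close> and the squared norm of
  \<open>XA v\<close> over \<open>n\<close>, which injectivity makes positive.\<close>

lemma lambda_min_Gram:
  assumes ne: "A \<noteq> {}"
  defines "l \<equiv> lambda_min ((1 / real n) \<cdot>\<^sub>m Gram)"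
  shows "0 < l"
    and "v \<in> carrier_vec (card A) \<Longrightarrow> real n * l * (v \<bullet> v) \<le> v \<bullet> (Gram *\<^sub>v v)"
proof -
  let ?S = "(1 / real n) \<cdot>\<^sub>m Gram"
  have S: "?S \<in> carrier_mat (card A) (card A)" using Gram by simp
  have "?S\<^sup>T = (1 / real n) \<cdot>\<^sub>m Gram\<^sup>T" by (intro eq_matI) auto
  then have sym: "?S\<^sup>T = ?S" by (simp add: Gram(2))
  have pos: "0 < card A" using ne finite_A by (simp add: card_gt_0_iff)
  have Sv: "?S *\<^sub>v v = (1 / real n) \<cdot>\<^sub>v (Gram *\<^sub>v v)" if "v \<in> carrier_vec (card A)" for v
    using Gram(1) that by (intro eq_vecI) (auto simp: scalar_prod_def sum_distrib_left mult_ac)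
  have form: "v \<bullet> (?S *\<^sub>v v) = v \<bullet> (Gram *\<^sub>v v) / real n" if "v \<in> carrier_vec (card A)" for v
    using Gram(1) that by (simp add: Sv scalar_prod_smult_distrib[of _ "card A"])
  show "real n * l * (v \<bullet> v) \<le> v \<bullet> (Gram *\<^sub>v v)" if v: "v \<in> carrier_vec (card A)"
    using eigenvalue_lambda_min(2)[OF S sym pos v] n
    by (simp add: form[OF v] l_def field_simps)
  obtain v where v: "v \<in> carrier_vec (card A)" "v \<noteq> 0\<^sub>v (card A)" "?S *\<^sub>v v = l \<cdot>\<^sub>v v"
    using eigenvalue_lambda_min(1)[OF S sym pos] S
    by (auto simp: eigenvalue_def eigenvector_def l_def)
  have "XA *\<^sub>v v \<noteq> 0\<^sub>v n" using XA_injective v by blast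
  then have "0 < (XA *\<^sub>v v) \<bullet> (XA *\<^sub>v v)"
    using scalar_prod_self_nonneg[of "XA *\<^sub>v v"] scalar_prod_self_eq_0_iff[of "XA *\<^sub>v v" n] by simp
  then have "0 < l * (v \<bullet> v)"
    using form[OF v(1)] n v(1) unfolding v(3) by (simp add: Gram_form scalar_prod_smult_distrib[of _ "card A"])
  then show "0 < l"
    using scalar_prod_self_nonneg[of v] by (simp add: zero_less_mult_iff)
qed

text \<open>The witness is \<open>r = X\<^sub>A v\<close> where \<open>v\<close> is the column of the inverse Gram matrix belonging
  to \<open>j\<close>; then \<open>r \<bullet> r\<close> is the diagonal entry of that inverse.\<close>
lemma active_error:
  assumes j: "j \<in> A"
  obtains r where "r \<in> carrier_vec n"
    "r \<bullet> r \<le> 1 / (real n * lambda_min ((1 / real n) \<cdot>\<^sub>m Gram))"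
    "\<And>\<beta>s e \<beta>. supported \<beta>s \<Longrightarrow> e \<in> carrier_vec n \<Longrightarrow>
      is_oracle_estimator X (X *\<^sub>v \<beta>s + e) A \<beta> \<Longrightarrow> \<beta> $ j = \<beta>s $ j + r \<bullet> e"
proof -
  have ne: "A \<noteq> {}" using j by blast
  define l where "l = real n * lambda_min ((1 / real n) \<cdot>\<^sub>m Gram)"
  have l: "0 < l" using lambda_min_Gram(1)[OF ne] n by (simp add: l_def)
  obtain i where i: "i < card A" "j = pick A i"
    using active_index[OF j] by blast
  obtain v where v: "v \<in> carrier_vec (card A)" "Gram *\<^sub>v v = unit_vec (card A) i"
    using Gram_solvable[of "unit_vec (card A) i"] by auto
  obtain w where w: "supported w" "X *\<^sub>v w = XA *\<^sub>v v"
    using supported_extend[OF v(1)] by blast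
  define r where "r = XA *\<^sub>v v"
  have r: "r \<in> carrier_vec n" by (simp add: r_def)
  have rr: "r \<bullet> r = v $ i"
    using Gram_form[OF v(1)] v i(1) by (simp add: r_def)
  \<comment> \<open>The chain gives \<open>l * (v $ i)^2 \<le> v $ i\<close>; cancelling
    \<open>v $ i = r \<bullet> r\<close> yields the bound \<open>1 / l\<close>.\<close>
  have "l * (v $ i)\<^sup>2 \<le> l * (v \<bullet> v)"
    using square_component_le_scalar_prod[OF v(1) i(1)] l by (intro mult_left_mono) auto
  also have "\<dots> \<le> v $ i"
    using lambda_min_Gram(2)[OF ne v(1)] v i(1) by (simp add: l_def)
  finally have "l * (v $ i) * (v $ i) \<le> 1 * (v $ i)" by (simp add: power2_eq_square)
  then have "r \<bullet> r \<le> 1 / l"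
    using l scalar_prod_self_nonneg[of r] unfolding rr
    by (cases "v $ i = 0") (auto simp: field_simps)
  moreover have "\<beta> $ j = \<beta>s $ j + r \<bullet> e"
    if \<beta>s: "supported \<beta>s" and e: "e \<in> carrier_vec n"
      and or: "is_oracle_estimator X (X *\<^sub>v \<beta>s + e) A \<beta>" for \<beta>s e \<beta>
  proof -
    have \<beta>: "supported \<beta>" using or by (simp add: is_oracle_estimator_iff)
    \<comment> \<open>Pairing with \<open>r\<close> reads off coordinate \<open>j\<close>, because
      the transpose of \<open>XA\<close> maps \<open>r\<close> to \<open>Gram v\<close>, a unit
      vector.\<close>
    have r_mult: "r \<bullet> (X *\<^sub>v u) = u $ j" if u: "supported u" for u
    proof -
      let ?u = "vec (card A) (\<lambda>i. u $ pick A i)"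
      have "r \<bullet> (X *\<^sub>v u) = (XA\<^sup>T *\<^sub>v r) \<bullet> ?u"
        using transpose_vec_mult_scalar[OF XA _ r, of ?u] by (simp add: supported_mult[OF u])
      also have "XA\<^sup>T *\<^sub>v r = unit_vec (card A) i"
        using v Gram_mult[OF v(1)] by (simp add: r_def)
      finally show ?thesis using i by simp
    qed
    have y: "X *\<^sub>v \<beta>s + e \<in> carrier_vec n" using e by simp
    \<comment> \<open>As \<open>r = X w\<close> lies in the active span, it is orthogonal to the
      oracle residual.\<close>
    have "0 = r \<bullet> (X *\<^sub>v \<beta>s + e - X *\<^sub>v \<beta>)"
      unfolding r_def w(2)[symmetric]
      by (rule supported_orthogonal[OF w(1), symmetric])
        (use e oracle_normal_equations[OF y or] in auto)
    also have "\<dots> = \<beta>s $ j + r \<bullet> e - \<beta> $ j"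
      using r e r_mult[OF \<beta>s] r_mult[OF \<beta>]
      by (simp add: scalar_prod_add_distrib[of _ n] scalar_prod_minus_distrib[of _ n])
    finally show ?thesis by simp
  qed
  ultimately show thesis
    using r that unfolding l_def by blast
qed

text \<open>With no penalty on \<open>A\<close> and weights off \<open>A\<close> exceeding the gradient of the loss at the
  oracle, the oracle satisfies the optimality conditions of the weighted problem strictly,
  so it is the only minimizer.\<close>
lemma lla_step_oracle:
  assumes y: "y \<in> carrier_vec n" and or: "is_oracle_estimator X y A \<beta>"
    and grad: "\<And>j. j < p \<Longrightarrow> j \<notin> A \<Longrightarrow> \<bar>col X j \<bullet> (y - X *\<^sub>v \<beta>)\<bar> / real n < \<kappa>"
    and active: "\<And>j. j \<in> A \<Longrightarrow> penalty_deriv P \<bar>\<beta>' $ j\<bar> = 0"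
    and inactive: "\<And>j. j < p \<Longrightarrow> j \<notin> A \<Longrightarrow> \<kappa> \<le> penalty_deriv P \<bar>\<beta>' $ j\<bar>"
    and min: "is_arg_min (lla_objective X y P \<beta>') (\<lambda>\<beta>. \<beta> \<in> carrier_vec p) b"
  shows "b = \<beta>"
proof -
  let ?w = "\<lambda>j. penalty_deriv P \<bar>\<beta>' $ j\<bar>"
  let ?g = "\<lambda>j. col X j \<bullet> (y - X *\<^sub>v \<beta>) / real n"
  have sup: "supported \<beta>" and \<beta>: "\<beta> \<in> carrier_vec p"
    using or by (auto simp: is_oracle_estimator_iff supported_def)
  have b: "b \<in> carrier_vec p" using min by (simp add: is_arg_min_linorder)
  define d where "d = b - \<beta>"
  have d: "d \<in> carrier_vec p" and bd: "b = \<beta> + d"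
    using b \<beta> by (auto simp: d_def)
  have r: "y - X *\<^sub>v \<beta> \<in> carrier_vec n" using y by simp
  have off: "d $ j = b $ j" if "j < p" "j \<notin> A" for j
    using that sup b \<beta> by (simp add: d_def supported_def)
  have pen: "(\<Sum>j<p. ?w j * \<bar>u $ j\<bar>) = (\<Sum>j\<in>{..<p} - A. ?w j * \<bar>u $ j\<bar>)" for u
    using active A by (intro sum.mono_neutral_right) auto
  have "(X *\<^sub>v d) \<bullet> (y - X *\<^sub>v \<beta>) = (\<Sum>j\<in>{..<p} - A. d $ j * (col X j \<bullet> (y - X *\<^sub>v \<beta>)))"
    unfolding scalar_prod_mult_cols[OF d r]
    using oracle_normal_equations[OF y or] A by (intro sum.mono_neutral_right) auto
  then have lin: "1 / real n * ((X *\<^sub>v d) \<bullet> (y - X *\<^sub>v \<beta>)) = (\<Sum>j\<in>{..<p} - A. b $ j * ?g j)"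
    by (simp add: off sum_divide_distrib)
  have "lla_objective X y P \<beta>' b \<le> lla_objective X y P \<beta>' \<beta>"
    using min \<beta> by (simp add: is_arg_min_linorder)
  moreover have "(\<Sum>j\<in>{..<p} - A. ?w j * \<bar>\<beta> $ j\<bar>) = 0"
    using sup by (intro sum.neutral) (auto simp: supported_def)
  ultimately have "ls_loss X y b + (\<Sum>j\<in>{..<p} - A. ?w j * \<bar>b $ j\<bar>) \<le> ls_loss X y \<beta>"
    by (simp add: lla_objective_def pen)
  \<comment> \<open>The quadratic expansion at the oracle turns minimality of \<open>b\<close> into
    a bound on two terms, each of which proves to be nonnegative; hence both vanish.\<close>
  then have le: "(\<Sum>j\<in>{..<p} - A. ?w j * \<bar>b $ j\<bar> - b $ j * ?g j)
      + 1 / (2 * real n) * ((X *\<^sub>v d) \<bullet> (X *\<^sub>v d)) \<le> 0"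
    using ls_loss_add[OF y \<beta> d] lin unfolding bd[symmetric] by (simp add: sum_subtractf)
  have gap: "(\<kappa> - \<bar>?g j\<bar>) * \<bar>b $ j\<bar> \<le> ?w j * \<bar>b $ j\<bar> - b $ j * ?g j"
    if j: "j < p" "j \<notin> A" for j
  proof -
    have "b $ j * ?g j \<le> \<bar>?g j\<bar> * \<bar>b $ j\<bar>"
      by (metis abs_ge_self abs_mult mult.commute)
    moreover have "\<kappa> * \<bar>b $ j\<bar> \<le> ?w j * \<bar>b $ j\<bar>"
      using inactive[OF j] by (intro mult_right_mono) auto
    ultimately show ?thesis by (simp add: left_diff_distrib)
  qed
  have gappos: "0 < \<kappa> - \<bar>?g j\<bar>" if "j < p" "j \<notin> A" for j
    using grad[OF that] by simp
  have nonneg: "0 \<le> ?w j * \<bar>b $ j\<bar> - b $ j * ?g j" if j: "j \<in> {..<p} - A" for j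
    using gap[of j] mult_nonneg_nonneg[OF less_imp_le[OF gappos[of j]], of "\<bar>b $ j\<bar>"] j by force
  have quad: "0 \<le> 1 / (2 * real n) * ((X *\<^sub>v d) \<bullet> (X *\<^sub>v d))"
    using scalar_prod_self_nonneg by simp
  have sum0: "(\<Sum>j\<in>{..<p} - A. ?w j * \<bar>b $ j\<bar> - b $ j * ?g j) = 0"
    by (rule antisym[OF _ sum_nonneg[OF nonneg]]) (use le quad in linarith)
  have "d $ j = 0" if j: "j < p" "j \<notin> A" for j
  proof -
    have "?w j * \<bar>b $ j\<bar> - b $ j * ?g j = 0"
      using sum_nonneg_0[OF _ nonneg sum0] j by simp
    then have "(\<kappa> - \<bar>?g j\<bar>) * \<bar>b $ j\<bar> \<le> 0" using gap[OF j] by simp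
    then show ?thesis using gappos[OF j] off[OF j] by (simp add: mult_le_0_iff)
  qed
  \<comment> \<open>The vanishing first term puts \<open>d\<close> in the active subspace and the
    vanishing second term gives \<open>X d = 0\<close>, so injectivity applies.\<close>
  then have "supported d" using d by (simp add: supported_def)
  moreover have "X *\<^sub>v d = 0\<^sub>v n"
  proof -
    have "1 / (2 * real n) * ((X *\<^sub>v d) \<bullet> (X *\<^sub>v d)) = 0"
      using le quad unfolding sum0 by linarith
    then show ?thesis using n scalar_prod_self_eq_0_iff[of "X *\<^sub>v d" n] by simp
  qed
  ultimately have "d = 0\<^sub>v p" by (rule injective)
  then show ?thesis using bd \<beta> by simp
qed

end

section \<open>Convergence of the LLA algorithm\<close>

theorem theorem3:
  fixes M :: "'w measure"
    and n p :: nat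
    and X :: "real mat"
    and \<beta>s :: "real vec"
    and \<epsilon> :: "nat \<Rightarrow> 'w \<Rightarrow> real"
    and y \<beta>init :: "'w \<Rightarrow> real vec"
    and b :: "nat \<Rightarrow> 'w \<Rightarrow> real vec"
    and P :: "real \<Rightarrow> real"
    and \<sigma> lam a1 a2 a a0 s \<delta>0 \<delta>1 \<delta>2 :: real
    and A :: "nat set"
  assumes "prob_space M"
    and "0 < n" and "0 < p"
    and "X \<in> carrier_mat n p" and "\<beta>s \<in> carrier_vec p"
    and "0 < \<sigma>"
    and "iid M \<epsilon> n" and "\<forall>i<n. sub_gaussian M \<sigma> (\<epsilon> i)"
    and "\<forall>\<omega>\<in>space M. y \<omega> = X *\<^sub>v \<beta>s + vec n (\<lambda>i. \<epsilon> i \<omega>)"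
    and "A = support \<beta>s" and "s = real (card A)"
    and "0 < lam" and "folded_concave_penalty a1 a2 a lam P"
    and "a0 = min 1 a2"
    and "A \<noteq> {} \<longrightarrow> norm_min_on A \<beta>s > (a + 1) * lam"
    and "\<forall>\<omega>\<in>space M. \<exists>!\<beta>. is_oracle_estimator X (y \<omega>) A \<beta>"
    and "random_vector M p \<beta>init"
    and "\<forall>m. random_vector M p (b m)"
    and "\<forall>\<omega>\<in>space M. lla_run X (y \<omega>) P (\<beta>init \<omega>) (\<lambda>m. b m \<omega>)"
    and "\<delta>0 = measure M {\<omega> \<in> space M. norm_max (\<beta>init \<omega> - \<beta>s) > a0 * lam}"
    and "\<delta>1 = 2 * (real p - s) *
           exp (- (a1\<^sup>2 * real n * lam\<^sup>2 / (2 * max_col_norm2 X * \<sigma>\<^sup>2)))"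
    and "\<delta>2 = 2 * s *
           exp (- (real n *
                   lambda_min ((1 / real n) \<cdot>\<^sub>m (transpose_mat (col_submatrix X A) * col_submatrix X A))
                     / (2 * \<sigma>\<^sup>2) * (norm_min_on A \<beta>s - a * lam)\<^sup>2))"
  shows "measure M {\<omega> \<in> space M. b 1 \<omega> = oracle_estimator X (y \<omega>) A \<and> b 2 \<omega> = oracle_estimator X (y \<omega>) A}
           \<ge> 1 - \<delta>0 - \<delta>1 - \<delta>2"
proof -

  \<comment> \<open>Deterministic structure and noise representation of the oracle\<close>
  interpret prob_space M by fact
  have A: "A \<subseteq> {..<p}" using assms(5,10) by (auto simp: support_def)
  interpret sparse_design X n p A
    by unfold_locales (use assms A in auto)
  define e where "e \<omega> = vec n (\<lambda>i. \<epsilon> i \<omega>)" for \<omega>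
  have e[simp]: "e \<omega> \<in> carrier_vec n" for \<omega> by (simp add: e_def)
  have sup: "supported \<beta>s"
    unfolding supported_def using assms(5,10) by (simp add: support_def)
  have y: "y \<omega> = X *\<^sub>v \<beta>s + e \<omega>" if "\<omega> \<in> space M" for \<omega>
    using assms(9) that by (simp add: e_def)
  have yc: "y \<omega> \<in> carrier_vec n" if "\<omega> \<in> space M" for \<omega>
    using y[OF that] by simp
  \<comment> \<open>The design is fixed, so uniqueness of the oracle at a single outcome
    suffices.\<close>
  interpret identifiable_design X n p A
  proof unfold_locales
    obtain \<omega> where "\<omega> \<in> space M" using not_empty by blast
    then show "d = 0\<^sub>v p" if "supported d" "X *\<^sub>v d = 0\<^sub>v n" for d
      using unique_oracle_injective[OF yc _ that] assms(16) by blast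
  qed
  define l where "l = lambda_min ((1 / real n) \<cdot>\<^sub>m Gram)"
  define N where "N = max_col_norm2 X"
  define \<tau> where "\<tau> = norm_min_on A \<beta>s - a * lam"
  define \<beta>o where "\<beta>o \<omega> = oracle_estimator X (y \<omega>) A" for \<omega>
  have or: "is_oracle_estimator X (y \<omega>) A (\<beta>o \<omega>)" if "\<omega> \<in> space M" for \<omega>
    unfolding \<beta>o_def oracle_estimator_def by (rule theI') (use assms(16) that in blast)
  \<comment> \<open>The vectors are chosen per coordinate but independently of
    \<open>\<omega>\<close>, as the tail bound for linear forms requires.\<close>
  have "\<forall>j. \<exists>r. j < p \<longrightarrow> r \<in> carrier_vec n \<and> r \<bullet> r \<le> col X j \<bullet> col X j \<and>
      (\<forall>\<omega>\<in>space M. col X j \<bullet> (y \<omega> - X *\<^sub>v \<beta>o \<omega>) = r \<bullet> e \<omega>)"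
    using inactive_residual sup e or y by metis
  then obtain R0 where R0: "\<And>j. j < p \<Longrightarrow> R0 j \<in> carrier_vec n"
    "\<And>j. j < p \<Longrightarrow> R0 j \<bullet> R0 j \<le> col X j \<bullet> col X j"
    "\<And>j \<omega>. j < p \<Longrightarrow> \<omega> \<in> space M \<Longrightarrow> col X j \<bullet> (y \<omega> - X *\<^sub>v \<beta>o \<omega>) = R0 j \<bullet> e \<omega>"
    by metis
  have "\<forall>j. \<exists>r. j \<in> A \<longrightarrow> r \<in> carrier_vec n \<and> r \<bullet> r \<le> 1 / (real n * l) \<and>
      (\<forall>\<omega>\<in>space M. \<beta>o \<omega> $ j = \<beta>s $ j + r \<bullet> e \<omega>)"
    unfolding l_def using active_error sup e or y by metis
  then obtain R1 where R1: "\<And>j. j \<in> A \<Longrightarrow> R1 j \<in> carrier_vec n"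
    "\<And>j. j \<in> A \<Longrightarrow> R1 j \<bullet> R1 j \<le> 1 / (real n * l)"
    "\<And>j \<omega>. j \<in> A \<Longrightarrow> \<omega> \<in> space M \<Longrightarrow> \<beta>o \<omega> $ j = \<beta>s $ j + R1 j \<bullet> e \<omega>"
    by metis
  have \<beta>o: "\<beta>o \<omega> \<in> carrier_vec p" "\<And>j. j < p \<Longrightarrow> j \<notin> A \<Longrightarrow> \<beta>o \<omega> $ j = 0"
    if "\<omega> \<in> space M" for \<omega>
    using or[OF that] by (auto simp: is_oracle_estimator_iff supported_def)

  \<comment> \<open>Measurability and tails of linear forms in the noise\<close>
  have indep: "indep_vars (\<lambda>_. borel) \<epsilon> {..<n}" using assms(7) by (simp add: iid_def)
  have [measurable]: "\<epsilon> i \<in> borel_measurable M" if "i < n" for i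
    using indep that by (simp add: indep_vars_def)
  have re: "r \<bullet> e \<omega> = (\<Sum>i<n. r $ i * \<epsilon> i \<omega>)" for r \<omega>
    by (simp add: scalar_prod_def e_def atLeast0LessThan)
  have re_meas[measurable]: "(\<lambda>\<omega>. r \<bullet> e \<omega>) \<in> borel_measurable M" for r
    unfolding re by measurable
  have tail: "prob {\<omega>\<in>space M. x \<le> \<bar>r \<bullet> e \<omega>\<bar>} \<le> 2 * exp (- (x\<^sup>2 / (2 * (\<sigma>\<^sup>2 * V))))"
    if "r \<in> carrier_vec n" "r \<bullet> r \<le> V" "0 < V" "0 \<le> x" for r x V
  proof (rule sub_gaussian_tail[OF _ re_meas _ _ \<open>0 \<le> x\<close>])
    show "sub_gaussian M (\<sigma> * sqrt (\<Sum>i<n. (r $ i)\<^sup>2)) (\<lambda>\<omega>. r \<bullet> e \<omega>)"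
      unfolding re using assms(8) by (intro sub_gaussian_linear_combination indep) auto
    have "(\<Sum>i<n. (r $ i)\<^sup>2) = r \<bullet> r"
      using that(1) by (simp add: scalar_prod_def power2_eq_square atLeast0LessThan)
    then show "(\<sigma> * sqrt (\<Sum>i<n. (r $ i)\<^sup>2))\<^sup>2 \<le> \<sigma>\<^sup>2 * V"
      using that(2) scalar_prod_self_nonneg[of r] by (simp add: power_mult_distrib mult_left_mono)
    show "0 < \<sigma>\<^sup>2 * V" using that(3) assms(6) by simp
  qed

  have pen: "0 < a1" "0 < a2" "a2 < a" "a1 * lam \<le> penalty_deriv P 0"
    "\<And>t. 0 < t \<Longrightarrow> t \<le> a2 * lam \<Longrightarrow> a1 * lam \<le> penalty_deriv P t"
    "\<And>t. a * lam \<le> t \<Longrightarrow> penalty_deriv P t = 0"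
    using assms(13) by (auto simp: folded_concave_penalty_def)
  have signal: "norm_min_on A \<beta>s \<le> \<bar>\<beta>s $ j\<bar>" "(a + 1) * lam < norm_min_on A \<beta>s" if "j \<in> A" for j
    using that finite_A assms(15) by (simp add: norm_min_on_def, blast)
  \<comment> \<open>For empty \<open>A\<close> nothing is known about \<open>\<tau>\<close>, but
    then no event \<open>E2 j\<close> is counted and \<open>\<delta>2\<close> vanishes through its
    factor \<open>s\<close>.\<close>
  have \<tau>: "0 \<le> \<tau>" if "j \<in> A" for j
    using signal(2)[OF that] \<open>0 < lam\<close> by (simp add: \<tau>_def distrib_right)

  have init: "\<beta>init \<omega> \<in> carrier_vec p" if "\<omega> \<in> space M" for \<omega>
    using assms(17) that by (simp add: random_vector_def)
  have [measurable]: "(\<lambda>\<omega>. \<beta>init \<omega> $ j) \<in> borel_measurable M" if "j < p" for j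
    using assms(17) that by (simp add: random_vector_def)
  have b: "b m \<omega> \<in> carrier_vec p" if "\<omega> \<in> space M" for m \<omega>
    using assms(18) that by (simp add: random_vector_def)
  have [measurable]: "(\<lambda>\<omega>. b m \<omega> $ j) \<in> borel_measurable M" if "j < p" for m j
    using assms(18) that by (simp add: random_vector_def)

  \<comment> \<open>Exceptional events and measurability\<close>
  define E0 where "E0 = {\<omega> \<in> space M. norm_max (\<beta>init \<omega> - \<beta>s) > a0 * lam}"
  define E1 where "E1 j = {\<omega> \<in> space M. real n * (a1 * lam) \<le> \<bar>R0 j \<bullet> e \<omega>\<bar>}" for j
  define E2 where "E2 j = {\<omega> \<in> space M. \<tau> \<le> \<bar>R1 j \<bullet> e \<omega>\<bar>}" for j
  define G where "G = {\<omega> \<in> space M. b 1 \<omega> = \<beta>o \<omega> \<and> b 2 \<omega> = \<beta>o \<omega>}"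
  have norm_max_gt: "norm_max (\<beta>init \<omega> - \<beta>s) > c \<longleftrightarrow> (\<exists>j<p. \<bar>\<beta>init \<omega> $ j - \<beta>s $ j\<bar> > c)"
    if "\<omega> \<in> space M" for \<omega> c
  proof -
    have "(\<lambda>j. \<bar>(\<beta>init \<omega> - \<beta>s) $ j\<bar>) ` {..<p} \<noteq> {}" using \<open>0 < p\<close> by auto
    then show ?thesis
      using assms(5) init[OF that] by (auto simp: norm_max_def Max_gr_iff)
  qed
  have "E0 = (\<Union>j<p. {\<omega> \<in> space M. \<bar>\<beta>init \<omega> $ j - \<beta>s $ j\<bar> > a0 * lam})"
    by (auto simp: E0_def norm_max_gt)
  then have E0: "E0 \<in> events" by simp
  have E1: "E1 j \<in> events" and E2: "E2 j \<in> events" for j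
    unfolding E1_def E2_def by measurable
  \<comment> \<open>Measurability of the oracle is not assumed; its noise representation reduces
    \<open>G\<close> to finitely many equations between measurable functions.\<close>
  have "G = {\<omega> \<in> space M. \<forall>j\<in>{..<p}.
      b 1 \<omega> $ j = (if j \<in> A then \<beta>s $ j + R1 j \<bullet> e \<omega> else 0) \<and>
      b 2 \<omega> $ j = (if j \<in> A then \<beta>s $ j + R1 j \<bullet> e \<omega> else 0)}"
  proof -
    have "b m \<omega> = \<beta>o \<omega> \<longleftrightarrow> (\<forall>j<p. b m \<omega> $ j = (if j \<in> A then \<beta>s $ j + R1 j \<bullet> e \<omega> else 0))"
      if \<omega>: "\<omega> \<in> space M" for m \<omega>
    proof -
      have "b m \<omega> = \<beta>o \<omega> \<longleftrightarrow> (\<forall>j<p. b m \<omega> $ j = \<beta>o \<omega> $ j)"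
        using b[OF \<omega>] \<beta>o(1)[OF \<omega>] by (auto intro!: eq_vecI)
      moreover have "\<beta>o \<omega> $ j = (if j \<in> A then \<beta>s $ j + R1 j \<bullet> e \<omega> else 0)" if "j < p" for j
        using \<beta>o(2)[OF \<omega> that] R1(3)[OF _ \<omega>] by simp
      ultimately show ?thesis by simp
    qed
    then show ?thesis by (auto simp: G_def)
  qed
  moreover have "\<dots> \<in> events" by measurable
  ultimately have G: "G \<in> events" by simp

  \<comment> \<open>Both LLA steps return the oracle outside the exceptional events\<close>
  have good: "\<omega> \<in> G"
    if \<omega>: "\<omega> \<in> space M" and 0: "\<omega> \<notin> E0"
      and 1: "\<And>j. j < p \<Longrightarrow> j \<notin> A \<Longrightarrow> \<omega> \<notin> E1 j" and 2: "\<And>j. j \<in> A \<Longrightarrow> \<omega> \<notin> E2 j" for \<omega>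
  proof -
    have close: "\<bar>\<beta>init \<omega> $ j - \<beta>s $ j\<bar> \<le> a0 * lam" if "j < p" for j
    proof (rule ccontr)
      assume "\<not> ?thesis"
      then have "\<omega> \<in> E0" using \<omega> that by (auto simp: E0_def norm_max_gt)
      with 0 show False ..
    qed
    have a0: "a0 * lam \<le> lam" "a0 * lam \<le> a2 * lam"
      using assms(12,14) by auto
    have grad: "\<bar>col X j \<bullet> (y \<omega> - X *\<^sub>v \<beta>o \<omega>)\<bar> / real n < a1 * lam" if "j < p" "j \<notin> A" for j
      using 1[OF that] \<omega> R0(3)[OF that(1) \<omega>] \<open>0 < n\<close> by (simp add: E1_def field_simps)
    have min: "is_arg_min (lla_objective X (y \<omega>) P (b m \<omega>)) (\<lambda>\<beta>. \<beta> \<in> carrier_vec p) (b (Suc m) \<omega>)"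
      and b0: "b 0 \<omega> = \<beta>init \<omega>" for m
      using assms(19) \<omega> by (auto simp: lla_run_def)
    have b1: "b (Suc 0) \<omega> = \<beta>o \<omega>"
    proof (rule lla_step_oracle[OF yc[OF \<omega>] or[OF \<omega>] grad _ _ min])
      fix j assume "j \<in> A"
      \<comment> \<open>An active true coordinate exceeds \<open>(a + 1) * lam\<close> in modulus,
        and the initial error costs at most \<open>lam\<close>.\<close>
      then have "a * lam \<le> \<bar>\<beta>init \<omega> $ j\<bar>"
        using close[of j] signal[of j] a0 A by (force simp: distrib_right)
      then show "penalty_deriv P \<bar>b 0 \<omega> $ j\<bar> = 0" by (simp add: b0 pen(6))
    next
      fix j assume j: "j < p" "j \<notin> A"
      then have "\<bar>\<beta>init \<omega> $ j\<bar> \<le> a2 * lam"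
        using close[of j] a0 sup by (simp add: supported_def)
      \<comment> \<open>A zero coordinate is weighted by the right limit at 0, which has its own
        lower bound.\<close>
      then show "a1 * lam \<le> penalty_deriv P \<bar>b 0 \<omega> $ j\<bar>"
        using pen(4) pen(5)[of "\<bar>\<beta>init \<omega> $ j\<bar>"] by (cases "\<beta>init \<omega> $ j = 0") (auto simp: b0)
    qed
    have b2: "b (Suc (Suc 0)) \<omega> = \<beta>o \<omega>"
    proof (rule lla_step_oracle[OF yc[OF \<omega>] or[OF \<omega>] grad _ _ min])
      fix j assume j: "j \<in> A"
      \<comment> \<open>Outside \<open>E2 j\<close> the oracle error is below \<open>\<tau>\<close>,
        the distance from the weakest signal to \<open>a * lam\<close>.\<close>
      have "a * lam \<le> \<bar>\<beta>o \<omega> $ j\<bar>"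
        using 2[OF j] \<omega> signal(1)[OF j] R1(3)[OF j \<omega>] by (simp add: E2_def \<tau>_def)
      then show "penalty_deriv P \<bar>b (Suc 0) \<omega> $ j\<bar> = 0" by (simp add: b1 pen(6))
    next
      fix j assume j: "j < p" "j \<notin> A"
      then show "a1 * lam \<le> penalty_deriv P \<bar>b (Suc 0) \<omega> $ j\<bar>"
        using \<beta>o(2)[OF \<omega> j] pen(4) by (simp add: b1)
    qed
    show ?thesis using b1 b2 \<omega> by (simp add: G_def numeral_2_eq_2)
  qed

  \<comment> \<open>Tail probabilities of the gradient and of the oracle error\<close>
  have P1: "prob (E1 j) \<le> 2 * exp (- (a1\<^sup>2 * real n * lam\<^sup>2 / (2 * N * \<sigma>\<^sup>2)))" if "j < p" for j
  proof -
    have xN: "1 / real n * (col X j \<bullet> col X j) \<le> N"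
      using that by (auto simp: N_def max_col_norm2_def intro!: Max_ge)
    moreover have "0 \<le> 1 / real n * (col X j \<bullet> col X j)"
      using scalar_prod_self_nonneg by simp
    ultimately have N: "0 \<le> N" by linarith
    have "col X j \<bullet> col X j \<le> real n * N"
      using xN \<open>0 < n\<close> by (simp add: field_simps)
    then have le: "R0 j \<bullet> R0 j \<le> real n * N"
      using R0(2)[OF that] by linarith
    show ?thesis
    proof (cases "N = 0")
      case True \<comment> \<open>division by \<open>N = 0\<close> turns the exponent into \<open>0\<close>, so the bound is \<open>2\<close>\<close>
      then show ?thesis by (simp add: order.trans[OF prob_le_1])
    next
      case False
      \<comment> \<open>The proxy is \<open>V = n N\<close>, while the threshold
        \<open>n a1 lam\<close> carries the factor \<open>n\<close> of the unnormalized gradient;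
        one \<open>n\<close> survives in the exponent.\<close>
      then have "prob (E1 j) \<le> 2 * exp (- ((real n * (a1 * lam))\<^sup>2 / (2 * (\<sigma>\<^sup>2 * (real n * N)))))"
        unfolding E1_def using le N pen \<open>0 < lam\<close> \<open>0 < n\<close> R0(1)[OF that] by (intro tail) auto
      also have "(real n * (a1 * lam))\<^sup>2 / (2 * (\<sigma>\<^sup>2 * (real n * N))) =
          a1\<^sup>2 * real n * lam\<^sup>2 / (2 * N * \<sigma>\<^sup>2)"
        using \<open>0 < n\<close> by (simp add: power2_eq_square mult_ac)
      finally show ?thesis .
    qed
  qed
  have P2: "prob (E2 j) \<le> 2 * exp (- (real n * l / (2 * \<sigma>\<^sup>2) * \<tau>\<^sup>2))" if j: "j \<in> A" for j
  proof -
    have "0 < l" unfolding l_def using lambda_min_Gram(1) j by blast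
    then have "prob (E2 j) \<le> 2 * exp (- (\<tau>\<^sup>2 / (2 * (\<sigma>\<^sup>2 * (1 / (real n * l))))))"
      unfolding E2_def using R1(1,2)[OF j] \<tau>[OF j] \<open>0 < n\<close> by (intro tail) auto
    also have "\<tau>\<^sup>2 / (2 * (\<sigma>\<^sup>2 * (1 / (real n * l)))) = real n * l / (2 * \<sigma>\<^sup>2) * \<tau>\<^sup>2"
      by simp
    finally show ?thesis .
  qed

  \<comment> \<open>Union bounds and conclusion\<close>
  have "prob (\<Union>j\<in>{..<p} - A. E1 j) \<le> (\<Sum>j\<in>{..<p} - A. prob (E1 j))"
    using E1 by (intro finite_measure_subadditive_finite) auto
  also have "\<dots> \<le> real (card ({..<p} - A)) * (2 * exp (- (a1\<^sup>2 * real n * lam\<^sup>2 / (2 * N * \<sigma>\<^sup>2))))"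
    by (rule sum_bounded_above) (use P1 in auto)
  also have "real (card ({..<p} - A)) = real p - s"
    using A finite_A card_mono[OF _ A] assms(11) by (simp add: card_Diff_subset of_nat_diff)
  also have "(real p - s) * (2 * exp (- (a1\<^sup>2 * real n * lam\<^sup>2 / (2 * N * \<sigma>\<^sup>2)))) = \<delta>1"
    by (simp add: assms(21) N_def)
  finally have U1: "prob (\<Union>j\<in>{..<p} - A. E1 j) \<le> \<delta>1" .
  have "prob (\<Union>j\<in>A. E2 j) \<le> (\<Sum>j\<in>A. prob (E2 j))"
    using E2 finite_A by (intro finite_measure_subadditive_finite) auto
  also have "\<dots> \<le> real (card A) * (2 * exp (- (real n * l / (2 * \<sigma>\<^sup>2) * \<tau>\<^sup>2)))"
    by (rule sum_bounded_above) (use P2 in auto)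
  also have "\<dots> = \<delta>2"
    by (simp add: assms(11,22) l_def Gram_def XA_def \<tau>_def)
  finally have U2: "prob (\<Union>j\<in>A. E2 j) \<le> \<delta>2" .

  let ?bad = "E0 \<union> ((\<Union>j\<in>{..<p} - A. E1 j) \<union> (\<Union>j\<in>A. E2 j))"
  have ev: "(\<Union>j\<in>{..<p} - A. E1 j) \<in> events" "(\<Union>j\<in>A. E2 j) \<in> events"
    using E1 E2 finite_A by auto
  have "prob ?bad \<le> prob E0 + prob ((\<Union>j\<in>{..<p} - A. E1 j) \<union> (\<Union>j\<in>A. E2 j))"
    using E0 ev by (intro measure_Un_le) auto
  also have "\<dots> \<le> prob E0 + (prob (\<Union>j\<in>{..<p} - A. E1 j) + prob (\<Union>j\<in>A. E2 j))"
    using ev by (intro add_left_mono measure_Un_le) auto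
  also have "\<dots> \<le> \<delta>0 + (\<delta>1 + \<delta>2)"
    using U1 U2 assms(20) by (simp add: E0_def)
  finally have bad: "prob ?bad \<le> \<delta>0 + (\<delta>1 + \<delta>2)" .
  have "1 - prob ?bad = prob (space M - ?bad)"
    using E0 ev by (intro prob_compl[symmetric]) auto
  also have "\<dots> \<le> prob G"
    using good by (intro finite_measure_mono G) auto
  finally show ?thesis using bad unfolding G_def \<beta>o_def by linarith
qed

end
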